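(* Let $\mathcal{X}_0$ and $\mathcal{X}_{\mathrm{in}}$ be finite sets with $d_0=|\mathcal{X}_0|>1$, let $G$ be a graph on $\mathcal{X}_{\mathrm{in}}$, and let $\mathbb{K}$ be a field. The (irredundant) primary decomposition of the binomial edge ideal $I_G$ is $$I_G=\bigcap_{\mathcal{Y}} I_{G,\mathcal{Y}},$$ where the intersection is over all $\mathcal{Y}\subseteq\mathcal{X}_{\mathrm{in}}$ such that the following holds: for any $x\in\mathcal{X}_{\mathrm{in}}\setminus\mathcal{Y}$ there are edges $(x,y)$, $(x,z)$ in $G$ such that $y,z\in\mathcal{Y}$ are not connected in $G_{\mathcal{Y}}$. Equivalently (this condition on $\mathcal{Y}$ is equivalent to the following one): for any $x\in\mathcal{X}_{\mathrm{in}}\setminus\mathcal{Y}$ the induced subgraph $G_{\mathcal{Y}\cup\{x\}}$ has fewer connected components than $G_{\mathcal{Y}}$.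
   Context: Graphs are finite, undirected, and edges join distinct vertices; "a graph on $\mathcal{X}_{\mathrm{in}}$" has vertex set $\mathcal{X}_{\mathrm{in}}$. For $i,j\in\mathcal{X}_0$ and $x,y\in\mathcal{X}_{\mathrm{in}}$ let $f^{ij}_{xy}=p_{ix}p_{jy}-p_{iy}p_{jx}$ in $\mathfrak{R}=\mathbb{K}[p_{ix}:i\in\mathcal{X}_0,x\in\mathcal{X}_{\mathrm{in}}]$. The ($d_0$th) binomial edge ideal $I_G$ is the ideal of $\mathfrak{R}$ generated by all $f^{ij}_{xy}$ with $i,j\in\mathcal{X}_0$ and $(x,y)$ an edge of $G$. For $\mathcal{Y}\subseteq\mathcal{X}_{\mathrm{in}}$, $G_{\mathcal{Y}}$ denotes the subgraph of $G$ induced by $\mathcal{Y}$. Two vertices are connected in a graph if they lie in the same connected component of it. The ideal $I_{G,\mathcal{Y}}\subseteq\mathfrak{R}$ is generated by the unknowns $p_{ix}$ for all $x\in\mathcal{X}_{\mathrm{in}}\setminus\mathcal{Y}$ and $i\in\mathcal{X}_0$, together with the binomials $f^{ij}_{xy}$ for all $i,j\in\mathcal{X}_0$ and all $x,y\in\mathcal{Y}$ that lie in the same connected component of $G_{\mathcal{Y}}$. *)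

theory Defs
  imports
    "HOL-Library.Poly_Mapping"
    "HOL-Algebra.Ideal"
    "Graph_Theory.Graph_Theory"
begin

section \<open>Primary decompositions\<close>

definition radical :: "('a, 'b) ring_scheme \<Rightarrow> 'a set \<Rightarrow> 'a set" where
  "radical R I = {a \<in> carrier R. \<exists>n::nat. n > 0 \<and> a [^]\<^bsub>R\<^esub> n \<in> I}"

definition primary_ideal :: "'a set \<Rightarrow> ('a, 'b) ring_scheme \<Rightarrow> bool" where
  "primary_ideal Q R \<longleftrightarrow>
     ideal Q R \<and> Q \<noteq> carrier R \<and>
     (\<forall>a\<in>carrier R. \<forall>b\<in>carrier R. a \<otimes>\<^bsub>R\<^esub> b \<in> Q \<longrightarrow> a \<in> Q \<or> b \<in> radical R Q)"

text \<open>
  The family of components is indexed by the set \<open>S\<close>. Irredundancy is taken in the usual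
  strong sense: no component contains the intersection of the others, and different components
  have different radicals. Intersecting with the carrier makes the empty intersection the whole
  ring.
\<close>

definition irredundant_primary_decomposition ::
    "('a, 'b) ring_scheme \<Rightarrow> 'a set \<Rightarrow> 's set \<Rightarrow> ('s \<Rightarrow> 'a set) \<Rightarrow> bool" where
  "irredundant_primary_decomposition R I S Q \<longleftrightarrow>
     finite S \<and>
     (\<forall>s\<in>S. primary_ideal (Q s) R) \<and>
     I = carrier R \<inter> (\<Inter>s\<in>S. Q s) \<and>
     (\<forall>s\<in>S. \<not> carrier R \<inter> (\<Inter>t\<in>S - {s}. Q t) \<subseteq> Q s) \<and>
     inj_on (\<lambda>s. radical R (Q s)) S"


section \<open>Polynomial rings\<close>

text \<open>
  Monomials are finitely supported exponent vectors, and polynomials are finitely supported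
  coefficient functions on monomials. The carrier consists of the polynomials in which only
  variables from \<open>V\<close> occur.
\<close>

type_synonym ('v, 'k) mpoly = "('v \<Rightarrow>\<^sub>0 nat) \<Rightarrow>\<^sub>0 'k"

definition poly_ring :: "'v set \<Rightarrow> ('v, 'k::field) mpoly ring" where
  "poly_ring V =
     \<lparr>carrier = {p. \<forall>m\<in>Poly_Mapping.keys p. Poly_Mapping.keys m \<subseteq> V},
      monoid.mult = (*), one = 1, ring.zero = 0, add = (+)\<rparr>"

definition pvar :: "'i \<Rightarrow> 'x \<Rightarrow> ('i \<times> 'x, 'k::field) mpoly" where
  "pvar i x = Poly_Mapping.single (Poly_Mapping.single (i, x) 1) 1"

definition fbinom :: "'i \<Rightarrow> 'i \<Rightarrow> 'x \<Rightarrow> 'x \<Rightarrow> ('i \<times> 'x, 'k::field) mpoly" where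
  "fbinom i j x y = pvar i x * pvar j y - pvar i y * pvar j x"


section \<open>Binomial edge ideals\<close>

text \<open>
  A finite simple graph is a \<open>pair_graph\<close>: a finite, loop-free, symmetric relation
  \<open>parcs G\<close> on \<open>pverts G\<close>, where each edge is represented by its two
  orientations. Since the relation is symmetric, the strongly connected components
  \<open>sccs\<close> are the connected components.
\<close>

definition binomial_edge_ideal :: "'i set \<Rightarrow> 'x pair_pre_digraph \<Rightarrow> ('i \<times> 'x, 'k::field) mpoly set" where
  "binomial_edge_ideal X0 G =
     Idl\<^bsub>poly_ring (X0 \<times> pverts G)\<^esub>
       {fbinom i j x y | i j x y. i \<in> X0 \<and> j \<in> X0 \<and> (x, y) \<in> parcs G}"

definition connected_in :: "('x, 'e) pre_digraph \<Rightarrow> 'x \<Rightarrow> 'x \<Rightarrow> bool" where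
  "connected_in H x y \<longleftrightarrow> (\<exists>C\<in>pre_digraph.sccs H. x \<in> verts C \<and> y \<in> verts C)"

definition component_ideal ::
    "'i set \<Rightarrow> 'x pair_pre_digraph \<Rightarrow> 'x set \<Rightarrow> ('i \<times> 'x, 'k::field) mpoly set" where
  "component_ideal X0 G Y =
     Idl\<^bsub>poly_ring (X0 \<times> pverts G)\<^esub>
       ({pvar i x | i x. i \<in> X0 \<and> x \<in> pverts G - Y} \<union>
        {fbinom i j x y | i j x y. i \<in> X0 \<and> j \<in> X0 \<and> x \<in> Y \<and> y \<in> Y \<and>
           connected_in (with_proj G \<restriction> Y) x y})"

definition separating :: "'x pair_pre_digraph \<Rightarrow> 'x set \<Rightarrow> bool" where
  "separating G Y \<longleftrightarrow>
     (\<forall>x\<in>pverts G - Y. \<exists>y\<in>Y. \<exists>z\<in>Y.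
        (x, y) \<in> parcs G \<and> (x, z) \<in> parcs G \<and> \<not> connected_in (with_proj G \<restriction> Y) y z)"

definition component_reducing :: "'x pair_pre_digraph \<Rightarrow> 'x set \<Rightarrow> bool" where
  "component_reducing G Y \<longleftrightarrow>
     (\<forall>x\<in>pverts G - Y.
        card (pre_digraph.sccs (with_proj G \<restriction> (Y \<union> {x})))
          < card (pre_digraph.sccs (with_proj G \<restriction> Y)))"

end

theory Submission
  imports Defs
begin

text \<open>
  The proof avoids Groebner bases and works over any field. Think of a monomial as a configuration
  of tokens, a factor \<open>p\<^bsub>ix\<^esub>\<close> being a token with label \<open>i\<close> at the vertex \<open>x\<close>. Modulo the binomial
  edge ideal, two tokens at adjacent vertices may exchange their labels. For a set \<open>Y\<close> of
  vertices let \<open>\<phi>\<^bsub>Y\<^esub>\<close> be the homomorphism that sends \<open>p\<^bsub>ix\<^esub>\<close> to \<open>t\<^bsub>x\<^esub> s\<^bsub>iC\<^esub>\<close> if \<open>x \<in> Y\<close>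
  lies in the component \<open>C\<close> of the graph induced on \<open>Y\<close>, and to zero if \<open>x \<notin> Y\<close>. Its image
  lies in an integral domain, so its kernel is prime, and this kernel is exactly the ideal
  attached to \<open>Y\<close> (\<open>component_ideal_eq_kernel_ideal\<close>).

  The combinatorial core is \<open>same_weight_imp_cong\<close>: if two configurations occupy the same set \<open>W\<close>
  of vertices and have the same image under \<open>\<phi>\<^bsub>W\<^esub>\<close>, then they are connected by exchanges along
  edges, because in a connected graph without empty vertices the labels can be permuted
  arbitrarily. The map \<open>\<phi>\<^bsub>W\<^esub>\<close> keeps track of the number of tokens at each vertex. Hence for a
  polynomial in the kernels of all \<open>\<phi>\<^bsub>W\<^esub>\<close> the part supported exactly on \<open>W\<close> is already in the
  binomial edge ideal, by looking at \<open>\<phi>\<^bsub>W\<^esub>\<close> alone. So the binomial edge ideal is the intersection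
  of the kernels for all subsets (\<open>binomial_edge_ideal_eq_Inter_all\<close>).

  It remains to discard the redundant subsets. If a vertex \<open>x \<notin> W\<close> does not join two components
  of \<open>W\<close>, then adding it to \<open>W\<close> does not change connectedness in \<open>W\<close>, and the ideal of the larger
  set is contained in that of \<open>W\<close>. Repeating this leads to a separating set. The ideals of
  different separating sets are incomparable (\<open>kernel_ideals_incomparable\<close>), which for primes
  gives irredundancy. Finally, both conditions on \<open>Y\<close> say that every vertex outside \<open>Y\<close> has
  neighbours in two components of \<open>Y\<close>.
\<close>

section \<open>Connectedness in induced subgraphs\<close>

lemma rtrancl_on_equiv:
  assumes "sym E"
  shows "equiv Y (rtrancl_on Y E)"
proof (rule equivI)
  show "rtrancl_on Y E \<subseteq> Y \<times> Y" by (auto dest: in_rtrancl_on_in_F)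
  show "refl_on Y (rtrancl_on Y E)" by (auto simp: refl_on_def)
  show "sym (rtrancl_on Y E)" using assms by (rule rtrancl_on_sym)
  show "trans (rtrancl_on Y E)" by (auto intro: transI rtrancl_on_trans)
qed

lemma rtrancl_on_subset:
  assumes "Y \<subseteq> Z" and "(x, y) \<in> rtrancl_on Y E"
  shows "(x, y) \<in> rtrancl_on Z E"
  using assms(2)
proof (induction rule: rtrancl_on_induct)
  case base
  then show ?case using assms(1) by auto
next
  case (step y z)
  then show ?case using assms(1) by (meson rtrancl_on_into_rtrancl_on subsetD)
qed

text \<open>
  For \<open>x \<notin> Y\<close> this is the local form of both conditions in the theorem: \<open>x\<close> has neighbours in
  two different components of the graph induced on \<open>Y\<close>.
\<close>

definition joins_components :: "'x rel \<Rightarrow> 'x set \<Rightarrow> 'x \<Rightarrow> bool" where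
  "joins_components E Y x \<longleftrightarrow>
     (\<exists>y\<in>Y. \<exists>z\<in>Y. (x, y) \<in> E \<and> (x, z) \<in> E \<and> (y, z) \<notin> rtrancl_on Y E)"

text \<open>
  A path through \<open>x\<close> enters and leaves \<open>x\<close> by neighbours of \<open>x\<close>. If all neighbours of \<open>x\<close> in \<open>Y\<close>
  are connected within \<open>Y\<close>, each such passage can be replaced by a path inside \<open>Y\<close>.
\<close>

lemma connected_insert_if_not_joining:
  assumes "sym E" and "\<not> joins_components E Y x" and "x \<notin> Y"
    and "a \<in> Y" and "b \<in> Y" and "(a, b) \<in> rtrancl_on (insert x Y) E"
  shows "(a, b) \<in> rtrancl_on Y E"
proof -
  have sym: "sym (rtrancl_on Y E)" using assms(1) by (rule rtrancl_on_sym)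
  \<comment> \<open>A walk that has stopped at \<open>x\<close> is tracked by its last vertex in \<open>Y\<close>.\<close>
  have "if b = x then \<exists>c\<in>Y. (c, x) \<in> E \<and> (a, c) \<in> rtrancl_on Y E else (a, b) \<in> rtrancl_on Y E"
    using assms(6)
  proof (induction rule: rtrancl_on_induct)
    case base
    then show ?case using assms by auto
  next
    case (step b c)
    show ?case
    proof (cases "b = x")
      case True
      with step.IH obtain d where d: "d \<in> Y" "(d, x) \<in> E" "(a, d) \<in> rtrancl_on Y E" by auto
      have "(a, c) \<in> rtrancl_on Y E" if "c \<noteq> x"
      proof -
        have "(x, c) \<in> E" "(x, d) \<in> E" "c \<in> Y"
          using step.hyps True d \<open>sym E\<close> that by (auto dest: symD)
        then have "(d, c) \<in> rtrancl_on Y E"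
          using assms(2) d(1) unfolding joins_components_def by blast
        with d show ?thesis by (blast intro: rtrancl_on_trans)
      qed
      with d show ?thesis by auto
    next
      case False
      with step show ?thesis by (auto intro: rtrancl_on_into_rtrancl_on)
    qed
  qed
  then show ?thesis using assms by (auto split: if_splits)
qed

text \<open>
  Sending a component of \<open>Y\<close> to the component of \<open>insert x Y\<close> that contains it compares the two
  counts. If \<open>x\<close> joins two components, this map is onto, because the new vertex lies in the image
  of an old component, but it is not injective. Otherwise it is injective.
\<close>

lemma joins_components_iff_fewer_classes:
  assumes "sym E" and "finite Y" and "x \<notin> Y"
  shows "joins_components E Y x \<longleftrightarrow>
    card (insert x Y // rtrancl_on (insert x Y) E) < card (Y // rtrancl_on Y E)"
proof -
  let ?r = "rtrancl_on Y E" and ?s = "rtrancl_on (insert x Y) E"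
  have eqr: "equiv Y ?r" and eqs: "equiv (insert x Y) ?s"
    using assms(1) by (auto intro: rtrancl_on_equiv)
  have rs: "(a, b) \<in> ?s" if "(a, b) \<in> ?r" for a b
    using that by (rule rtrancl_on_subset[rotated]) auto
  define f where "f C = ?s `` C" for C
  have f: "f (?r `` {a}) = ?s `` {a}" if "a \<in> Y" for a
  proof -
    have "?r `` {a} \<subseteq> ?s `` {a}" using rs by auto
    moreover have "a \<in> ?r `` {a}" using that by auto
    ultimately show ?thesis
      using eqs unfolding f_def by (auto dest: rtrancl_on_trans)
  qed
  have fin: "finite (Y // ?r)" "finite (insert x Y // ?s)"
    using assms(2) eqr eqs by (auto intro!: finite_quotient simp: equiv_def)
  have into: "f ` (Y // ?r) \<subseteq> insert x Y // ?s"
    using f by (auto simp: quotient_def)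
  show ?thesis
  proof
    assume "joins_components E Y x"
    then obtain y z where yz: "y \<in> Y" "z \<in> Y" "(x, y) \<in> E" "(x, z) \<in> E" "(y, z) \<notin> ?r"
      unfolding joins_components_def by blast
    have xy: "(x, y) \<in> ?s" "(x, z) \<in> ?s"
      using yz by (auto intro: rtrancl_on_into_rtrancl_on)
    then have xy_eq: "?s `` {x} = ?s `` {y}" "?s `` {x} = ?s `` {z}"
      using equiv_class_eq[OF eqs] by blast+
    have "insert x Y // ?s \<subseteq> f ` (Y // ?r)"
    proof
      fix C assume "C \<in> insert x Y // ?s"
      then obtain a where "a \<in> insert x Y" "C = ?s `` {a}" by (auto elim: quotientE)
      then obtain b where "b \<in> Y" "C = ?s `` {b}" using xy_eq yz by auto
      then show "C \<in> f ` (Y // ?r)" using f by (auto simp: quotient_def)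
    qed
    with into have img: "f ` (Y // ?r) = insert x Y // ?s" by blast
    have "\<not> inj_on f (Y // ?r)"
    proof
      assume "inj_on f (Y // ?r)"
      moreover have "f (?r `` {y}) = f (?r `` {z})" using f yz xy_eq by auto
      ultimately have "?r `` {y} = ?r `` {z}"
        using yz by (auto dest: inj_onD simp: quotientI)
      then show False using yz eq_equiv_class[OF _ eqr] by blast
    qed
    then have "card (f ` (Y // ?r)) \<noteq> card (Y // ?r)"
      using fin by (auto simp: inj_on_iff_eq_card)
    with card_image_le[OF fin(1), of f]
    show "card (insert x Y // ?s) < card (Y // ?r)" unfolding img by auto
  next
    assume less: "card (insert x Y // ?s) < card (Y // ?r)"
    show "joins_components E Y x"
    proof (rule ccontr)
      assume nb: "\<not> joins_components E Y x"
      have "inj_on f (Y // ?r)"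
      proof (rule inj_onI)
        fix C D assume "C \<in> Y // ?r" "D \<in> Y // ?r" and eq: "f C = f D"
        then obtain a b where ab: "a \<in> Y" "C = ?r `` {a}" "b \<in> Y" "D = ?r `` {b}"
          by (auto elim!: quotientE)
        with eq f have "?s `` {a} = ?s `` {b}" by auto
        then have "(a, b) \<in> ?s" using eq_equiv_class[OF _ eqs] ab by blast
        then have "(a, b) \<in> ?r" using connected_insert_if_not_joining assms nb ab by metis
        then show "C = D" using ab equiv_class_eq[OF eqr] by auto
      qed
      then have "card (Y // ?r) \<le> card (insert x Y // ?s)"
        using into fin by (intro card_inj_on_le[of f]) auto
      with less show False by simp
    qed
  qed
qed

text \<open>
  Adding to \<open>W\<close>, one after the other, vertices that do not join two components never connects
  vertices of \<open>W\<close> that were not connected before. Since \<open>V\<close> is finite, this stops, and then every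
  vertex that is left joins two components.
\<close>

lemma joining_superset:
  assumes "finite V" and "sym E" and "W \<subseteq> V"
  obtains Y where "W \<subseteq> Y" and "Y \<subseteq> V" and "\<forall>x\<in>V - Y. joins_components E Y x"
    and "rtrancl_on Y E \<inter> W \<times> W \<subseteq> rtrancl_on W E"
proof -
  have "\<exists>Y. W \<subseteq> Y \<and> Y \<subseteq> V \<and> (\<forall>x\<in>V - Y. joins_components E Y x) \<and>
      rtrancl_on Y E \<inter> W \<times> W \<subseteq> rtrancl_on W E"
    using assms(3)
  proof (induction "card (V - W)" arbitrary: W rule: less_induct)
    case less
    show ?case
    proof (cases "\<forall>x\<in>V - W. joins_components E W x")
      case True
      then show ?thesis using less.prems by blast
    next
      case False
      then obtain x where x: "x \<in> V - W" "\<not> joins_components E W x" by blast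
      have "V - insert x W \<subset> V - W" using x by auto
      then have "card (V - insert x W) < card (V - W)"
        using assms(1) by (intro psubset_card_mono) auto
      moreover have "insert x W \<subseteq> V" using x less.prems by auto
      ultimately obtain Y where
        Y: "insert x W \<subseteq> Y" "Y \<subseteq> V" "\<forall>x\<in>V - Y. joins_components E Y x"
          "rtrancl_on Y E \<inter> insert x W \<times> insert x W \<subseteq> rtrancl_on (insert x W) E"
        using less.hyps[of "insert x W"] by blast
      have "rtrancl_on Y E \<inter> W \<times> W \<subseteq> rtrancl_on W E"
        using Y(4) x connected_insert_if_not_joining[OF assms(2) x(2)] by blast
      with Y show ?thesis by blast
    qed
  qed
  then show thesis using that by blast
qed

text \<open>
  Reachability is symmetric here, so the vertex sets of the strongly connected components are the
  classes of the reachability relation.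
\<close>

lemma sccs_verts_induced:
  assumes "pair_graph G" and "Y \<subseteq> pverts G"
  shows "pre_digraph.sccs_verts (with_proj G \<restriction> Y) = Y // rtrancl_on Y (parcs G)"
proof -
  interpret pair_graph G by fact
  let ?r = "rtrancl_on Y (parcs G)"
  have eqr: "equiv Y ?r" using sym_arcs by (intro rtrancl_on_equiv) (simp add: symmetric_def)
  have ends: "arcs_ends (with_proj G \<restriction> Y) = Restr (parcs G) Y"
    by (auto simp: arcs_ends_conv)
  have "rtrancl_on Y (Restr (parcs G) Y) = ?r" (is "?l = _")
  proof (intro equalityI subrelI)
    show "(a, b) \<in> ?r" if "(a, b) \<in> ?l" for a b
      using that by (induction rule: rtrancl_on_induct) (auto intro: rtrancl_on_into_rtrancl_on dest: in_rtrancl_on_in_F)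
    show "(a, b) \<in> ?l" if "(a, b) \<in> ?r" for a b
      using that by (induction rule: rtrancl_on_induct) (auto intro: rtrancl_on_into_rtrancl_on dest: in_rtrancl_on_in_F)
  qed
  then have reach: "reachable (with_proj G \<restriction> Y) u v \<longleftrightarrow> (u, v) \<in> ?r" for u v
    by (simp add: reachable_def ends)
  have sym: "(u, v) \<in> ?r \<longleftrightarrow> (v, u) \<in> ?r" for u v
    using eqr by (meson equiv_def symE)
  show ?thesis
  proof (intro equalityI subsetI)
    fix S assume "S \<in> pre_digraph.sccs_verts (with_proj G \<restriction> Y)"
    then have S: "S \<noteq> {}" "\<And>u v. u \<in> S \<Longrightarrow> v \<in> S \<Longrightarrow> (u, v) \<in> ?r"
      "\<And>u v. u \<in> S \<Longrightarrow> v \<notin> S \<Longrightarrow> (u, v) \<notin> ?r"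
      unfolding pre_digraph.sccs_verts_def reach using sym by auto
    then obtain u where u: "u \<in> S" by auto
    then have "S = ?r `` {u}" using S by auto
    moreover have "u \<in> Y" using S(2)[OF u u] by (auto dest: in_rtrancl_on_in_F)
    ultimately show "S \<in> Y // ?r" by (auto intro: quotientI)
  next
    fix S assume "S \<in> Y // ?r"
    then obtain u where u: "u \<in> Y" "S = ?r `` {u}" by (auto elim: quotientE)
    then have "S \<noteq> {}" by auto
    moreover have "(a, b) \<in> ?r" if "a \<in> S" "b \<in> S" for a b
      using that u sym by (blast intro: rtrancl_on_trans)
    moreover have "(a, b) \<notin> ?r" if "a \<in> S" "b \<notin> S" for a b
      using that u by (blast intro: rtrancl_on_trans)
    ultimately show "S \<in> pre_digraph.sccs_verts (with_proj G \<restriction> Y)"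
      unfolding pre_digraph.sccs_verts_def reach by blast
  qed
qed

lemma connected_in_induced_iff:
  assumes "pair_graph G" and "Y \<subseteq> pverts G"
  shows "connected_in (with_proj G \<restriction> Y) x y \<longleftrightarrow> (x, y) \<in> rtrancl_on Y (parcs G)"
proof -
  interpret pair_graph G by fact
  interpret H: wf_digraph "with_proj G \<restriction> Y" by (rule wellformed_induce_subgraph)
  have eqr: "equiv Y (rtrancl_on Y (parcs G))"
    using sym_arcs by (intro rtrancl_on_equiv) (simp add: symmetric_def)
  have "connected_in (with_proj G \<restriction> Y) x y \<longleftrightarrow> (\<exists>C\<in>H.sccs_verts. x \<in> C \<and> y \<in> C)"
    unfolding connected_in_def H.sccs_verts_conv by auto
  also have "\<dots> \<longleftrightarrow> (x, y) \<in> rtrancl_on Y (parcs G)"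
    unfolding sccs_verts_induced[OF assms]
  proof
    assume "\<exists>C\<in>Y // rtrancl_on Y (parcs G). x \<in> C \<and> y \<in> C"
    then show "(x, y) \<in> rtrancl_on Y (parcs G)"
      using quotient_eq_iff[OF eqr] by blast
  next
    assume xy: "(x, y) \<in> rtrancl_on Y (parcs G)"
    then have "x \<in> Y" by (rule in_rtrancl_on_in_F)
    then show "\<exists>C\<in>Y // rtrancl_on Y (parcs G). x \<in> C \<and> y \<in> C"
      using xy by (intro bexI[of _ "rtrancl_on Y (parcs G) `` {x}"]) (auto intro: quotientI)
  qed
  finally show ?thesis .
qed

lemma separating_iff_joins_components:
  assumes "pair_graph G" and "Y \<subseteq> pverts G"
  shows "separating G Y \<longleftrightarrow> (\<forall>x\<in>pverts G - Y. joins_components (parcs G) Y x)"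
  unfolding separating_def joins_components_def connected_in_induced_iff[OF assms] ..

lemma component_reducing_iff_joins_components:
  assumes "pair_graph G" and "Y \<subseteq> pverts G"
  shows "component_reducing G Y \<longleftrightarrow> (\<forall>x\<in>pverts G - Y. joins_components (parcs G) Y x)"
proof -
  interpret pair_graph G by fact
  have sym: "sym (parcs G)" using sym_arcs by (simp add: symmetric_def)
  have card: "card (pre_digraph.sccs (with_proj G \<restriction> Z)) = card (Z // rtrancl_on Z (parcs G))"
    if "Z \<subseteq> pverts G" for Z
  proof -
    interpret H: wf_digraph "with_proj G \<restriction> Z" by (rule wellformed_induce_subgraph)
    show ?thesis using H.card_sccs_verts sccs_verts_induced[OF assms(1) that] by simp
  qed
  have "finite Y" using assms(2) pair_finite_verts by (rule finite_subset)
  then have "joins_components (parcs G) Y x \<longleftrightarrow>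
      card (pre_digraph.sccs (with_proj G \<restriction> (Y \<union> {x})))
        < card (pre_digraph.sccs (with_proj G \<restriction> Y))"
    if "x \<in> pverts G - Y" for x
    using that assms(2) joins_components_iff_fewer_classes[OF sym] by (simp add: card)
  then show ?thesis unfolding component_reducing_def by blast
qed

section \<open>Finitely supported functions and pushforwards\<close>

lemma keys_add_nat: "Poly_Mapping.keys (a + b) = Poly_Mapping.keys a \<union> Poly_Mapping.keys b"
  for a b :: "'a \<Rightarrow>\<^sub>0 nat"
  by (auto simp: in_keys_iff lookup_add)

lemma single_sum:
  "Poly_Mapping.single a (\<Sum>s\<in>S. f s) = (\<Sum>s\<in>S. Poly_Mapping.single a (f s))"
  by (induction S rule: infinite_finite_induct) (simp_all add: single_add)

lemma single_eq_0_iff [simp]: "Poly_Mapping.single a c = 0 \<longleftrightarrow> c = 0"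
  by (metis keys_eq_empty keys_single insert_not_empty)

lemma poly_mapping_eq_sum_single:
  "p = (\<Sum>a\<in>Poly_Mapping.keys p. Poly_Mapping.single a (Poly_Mapping.lookup p a))"
  for p :: "'a \<Rightarrow>\<^sub>0 'b::comm_monoid_add"
  by (rule poly_mapping_eqI)
    (simp add: lookup_sum lookup_single when_def in_keys_iff)

text \<open>
  Monomials are written additively, as exponent vectors; a factor \<open>v\<close> of a monomial is the
  summand \<open>single v 1\<close>.
\<close>

lemma split_off_variable:
  fixes m :: "'v \<Rightarrow>\<^sub>0 nat"
  assumes "v \<in> Poly_Mapping.keys m"
  obtains m' where "m = m' + Poly_Mapping.single v 1"
proof
  show "m = (m - Poly_Mapping.single v 1) + Poly_Mapping.single v 1"
    using assms
    by (intro poly_mapping_eqI) (auto simp: lookup_add lookup_minus lookup_single when_def in_keys_iff)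
qed

lemma monomial_induct [case_names one times_variable]:
  fixes m :: "'v \<Rightarrow>\<^sub>0 nat"
  assumes "P 0" and "\<And>m v. P m \<Longrightarrow> P (m + Poly_Mapping.single v 1)"
  shows "P m"
proof (induction "\<Sum>v\<in>Poly_Mapping.keys m. Poly_Mapping.lookup m v" arbitrary: m rule: less_induct)
  case less
  show ?case
  proof (cases "m = 0")
    case True
    then show ?thesis using assms(1) by simp
  next
    case False
    then obtain v where "v \<in> Poly_Mapping.keys m" by (metis all_not_in_conv keys_eq_empty)
    then obtain m' where m': "m = m' + Poly_Mapping.single v 1" by (rule split_off_variable)
    have "(\<Sum>v\<in>Poly_Mapping.keys m. Poly_Mapping.lookup m v) =
      (\<Sum>v\<in>Poly_Mapping.keys m'. Poly_Mapping.lookup m' v) + 1"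
      unfolding m' using setsum_keys_plus_distrib[of "\<lambda>_ n. n" m' "Poly_Mapping.single v 1"] by simp
    then have "P m'" using less by simp
    then show ?thesis unfolding m' by (rule assms(2))
  qed
qed

text \<open>
  The pushforward of a finitely supported function along \<open>g\<close>, with the part outside \<open>M\<close>
  discarded. It serves twice: on exponent vectors it renames variables, possibly identifying some
  of them, and on polynomials for additive \<open>g\<close>, it is the ring homomorphism that maps monomials in \<open>M\<close> to monomials
  and all others to zero.
\<close>

definition push_on :: "'a set \<Rightarrow> ('a \<Rightarrow> 'b) \<Rightarrow> ('a \<Rightarrow>\<^sub>0 'c::comm_monoid_add) \<Rightarrow> ('b \<Rightarrow>\<^sub>0 'c)" where
  "push_on M g p =
     (\<Sum>a\<in>Poly_Mapping.keys p \<inter> M. Poly_Mapping.single (g a) (Poly_Mapping.lookup p a))"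

lemma push_on_superset:
  assumes "finite S" and "Poly_Mapping.keys p \<subseteq> S"
  shows "push_on M g p = (\<Sum>a\<in>S \<inter> M. Poly_Mapping.single (g a) (Poly_Mapping.lookup p a))"
  unfolding push_on_def using assms
  by (intro sum.mono_neutral_left) (auto simp: in_keys_iff)

lemma push_on_add: "push_on M g (p + q) = push_on M g p + push_on M g q"
proof -
  let ?S = "Poly_Mapping.keys p \<union> Poly_Mapping.keys q"
  have "finite ?S" "Poly_Mapping.keys (p + q) \<subseteq> ?S" using keys_add[of p q] by simp_all
  then show ?thesis
    by (simp add: push_on_superset[of ?S] lookup_add single_add sum.distrib)
qed

lemma push_on_0 [simp]: "push_on M g 0 = 0"
  by (simp add: push_on_def)

lemma push_on_sum: "push_on M g (\<Sum>a\<in>A. f a) = (\<Sum>a\<in>A. push_on M g (f a))"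
  by (induction A rule: infinite_finite_induct) (auto simp: push_on_add)

lemma push_on_diff: "push_on M g (p - q) = push_on M g p - push_on M g q"
  for p q :: "'a \<Rightarrow>\<^sub>0 'c::ab_group_add"
  using push_on_add[of M g "p - q" q] by simp

lemma push_on_single [simp]:
  "push_on M g (Poly_Mapping.single a c) = (if a \<in> M then Poly_Mapping.single (g a) c else 0)"
  by (auto simp: push_on_def)

lemma lookup_push_on:
  "Poly_Mapping.lookup (push_on M g p) b =
     (\<Sum>a\<in>{a \<in> Poly_Mapping.keys p. a \<in> M \<and> g a = b}. Poly_Mapping.lookup p a)"
proof -
  have "Poly_Mapping.lookup (push_on M g p) b =
      (\<Sum>a\<in>Poly_Mapping.keys p \<inter> M. if g a = b then Poly_Mapping.lookup p a else 0)"
    by (simp add: push_on_def lookup_sum lookup_single when_def)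
  also have "\<dots> = (\<Sum>a\<in>Poly_Mapping.keys p \<inter> M \<inter> {a. g a = b}. Poly_Mapping.lookup p a)"
    by (simp add: sum.inter_restrict)
  also have "Poly_Mapping.keys p \<inter> M \<inter> {a. g a = b} = {a \<in> Poly_Mapping.keys p. a \<in> M \<and> g a = b}"
    by blast
  finally show ?thesis .
qed

lemma keys_push_on_nat: "Poly_Mapping.keys (push_on UNIV g m) = g ` Poly_Mapping.keys m"
  for m :: "'a \<Rightarrow>\<^sub>0 nat"
  by (auto simp: in_keys_iff[of _ "push_on UNIV g m"] lookup_push_on)
    (auto simp: in_keys_iff)

text \<open>
  The condition on \<open>M\<close> says that the discarded monomials span an ideal and that the others are
  closed under multiplication, so discarding is compatible with products.
\<close>

lemma push_on_mult:
  fixes p q :: "'a::comm_monoid_add \<Rightarrow>\<^sub>0 'c::comm_semiring_0"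
  assumes M: "\<And>a b. a + b \<in> M \<longleftrightarrow> a \<in> M \<and> b \<in> M" and g: "\<And>a b. g (a + b) = g a + g b"
  shows "push_on M g (p * q) = push_on M g p * push_on M g q"
proof -
  let ?s = "\<lambda>p a. Poly_Mapping.single a (Poly_Mapping.lookup p a)"
  have "p * q = (\<Sum>a\<in>Poly_Mapping.keys p. ?s p a) * (\<Sum>b\<in>Poly_Mapping.keys q. ?s q b)"
    by (simp flip: poly_mapping_eq_sum_single)
  also have "push_on M g \<dots> =
      (\<Sum>a\<in>Poly_Mapping.keys p. \<Sum>b\<in>Poly_Mapping.keys q. push_on M g (?s p a * ?s q b))"
    by (simp add: sum_product push_on_sum)
  also have "\<dots> = (\<Sum>a\<in>Poly_Mapping.keys p. \<Sum>b\<in>Poly_Mapping.keys q.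
      push_on M g (?s p a) * push_on M g (?s q b))"
    by (intro sum.cong refl) (auto simp: mult_single M g)
  also have "\<dots> = push_on M g (\<Sum>a\<in>Poly_Mapping.keys p. ?s p a) *
      push_on M g (\<Sum>b\<in>Poly_Mapping.keys q. ?s q b)"
    by (simp only: push_on_sum sum_product)
  finally show ?thesis by (simp flip: poly_mapping_eq_sum_single)
qed

section \<open>Polynomial rings and their ideals\<close>

lemma carrier_poly_ring:
  "p \<in> carrier (poly_ring A) \<longleftrightarrow> (\<forall>m\<in>Poly_Mapping.keys p. Poly_Mapping.keys m \<subseteq> A)"
  by (simp add: poly_ring_def)

lemma poly_ring_simps [simp]:
  "x \<otimes>\<^bsub>poly_ring A\<^esub> y = x * y" "x \<oplus>\<^bsub>poly_ring A\<^esub> y = x + y"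
  "\<one>\<^bsub>poly_ring A\<^esub> = 1" "\<zero>\<^bsub>poly_ring A\<^esub> = 0"
  by (simp_all add: poly_ring_def)

lemma poly_ring_closed:
  fixes p q :: "('v, 'k::field) mpoly"
  shows
  "(0 :: ('v, 'k) mpoly) \<in> carrier (poly_ring A)"
  "(1 :: ('v, 'k) mpoly) \<in> carrier (poly_ring A)"
  "p \<in> carrier (poly_ring A) \<Longrightarrow> q \<in> carrier (poly_ring A) \<Longrightarrow> p + q \<in> carrier (poly_ring A)"
  "p \<in> carrier (poly_ring A) \<Longrightarrow> - p \<in> carrier (poly_ring A)"
  "p \<in> carrier (poly_ring A) \<Longrightarrow> q \<in> carrier (poly_ring A) \<Longrightarrow> p - q \<in> carrier (poly_ring A)"
  "p \<in> carrier (poly_ring A) \<Longrightarrow> q \<in> carrier (poly_ring A) \<Longrightarrow> p * q \<in> carrier (poly_ring A)"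
  "Poly_Mapping.keys m \<subseteq> A \<Longrightarrow> (Poly_Mapping.single m c :: ('v, 'k) mpoly) \<in> carrier (poly_ring A)"
proof -
  show add: "p + q \<in> carrier (poly_ring A)"
    if "p \<in> carrier (poly_ring A)" "q \<in> carrier (poly_ring A)"
    for p q :: "('v, 'k) mpoly"
    using that keys_add[of p q] unfolding carrier_poly_ring by blast
  show neg: "- p \<in> carrier (poly_ring A)" if "p \<in> carrier (poly_ring A)"
    for p :: "('v, 'k) mpoly"
    using that unfolding carrier_poly_ring by (simp add: in_keys_iff)
  show "p - q \<in> carrier (poly_ring A)"
    if "p \<in> carrier (poly_ring A)" "q \<in> carrier (poly_ring A)"
    for p q :: "('v, 'k) mpoly"
    using add[OF that(1) neg[OF that(2)]] by simp
  show "p * q \<in> carrier (poly_ring A)"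
    if "p \<in> carrier (poly_ring A)" "q \<in> carrier (poly_ring A)"
    for p q :: "('v, 'k) mpoly"
    using that keys_mult[of p q] unfolding carrier_poly_ring by (fastforce simp: keys_add_nat)
qed (auto simp: carrier_poly_ring split: if_splits)

lemma cring_poly_ring: "cring (poly_ring A)"
proof (rule cringI)
  show "abelian_group (poly_ring A)"
  proof (rule abelian_groupI)
    fix p assume "p \<in> carrier (poly_ring A)"
    then show "\<exists>q\<in>carrier (poly_ring A). q \<oplus>\<^bsub>poly_ring A\<^esub> p = \<zero>\<^bsub>poly_ring A\<^esub>"
      by (intro bexI[of _ "- p"]) (auto intro: poly_ring_closed)
  qed (auto intro: poly_ring_closed simp: ac_simps)
  show "Group.comm_monoid (poly_ring A)"
    by (rule comm_monoidI) (auto intro: poly_ring_closed simp: ac_simps)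
qed (auto simp: distrib_right)

lemma poly_ring_nat_pow: "p [^]\<^bsub>poly_ring A\<^esub> (n::nat) = p ^ n"
  by (induction n) (simp_all add: nat_pow_def poly_ring_def mult.commute)

text \<open>
  For an ideal of the record-based ring, the closure properties are restated in terms of the
  type class operations.
\<close>

context
  fixes J :: "('v, 'k::field) mpoly set" and A :: "'v set"
  assumes J: "ideal J (poly_ring A)"
begin

lemma poly_ideal_zero: "0 \<in> J"
  using additive_subgroup.zero_closed[OF ideal.axioms(1)[OF J]] by simp

lemma poly_ideal_add: "p \<in> J \<Longrightarrow> q \<in> J \<Longrightarrow> p + q \<in> J"
  using additive_subgroup.a_closed[OF ideal.axioms(1)[OF J]] by simp

lemma poly_ideal_mult: "p \<in> J \<Longrightarrow> q \<in> carrier (poly_ring A) \<Longrightarrow> q * p \<in> J"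
  using ideal.I_l_closed[OF J] by simp

lemma poly_ideal_diff: "p \<in> J \<Longrightarrow> q \<in> J \<Longrightarrow> p - q \<in> J"
  using poly_ideal_add[of p "- 1 * q"] poly_ideal_mult[of q "- 1"]
  by (simp add: poly_ring_closed)

lemma poly_ideal_sum: "(\<And>s. s \<in> S \<Longrightarrow> f s \<in> J) \<Longrightarrow> (\<Sum>s\<in>S. f s) \<in> J"
  by (induction S rule: infinite_finite_induct) (auto intro: poly_ideal_zero poly_ideal_add)

text \<open>
  If monomials of the same class are congruent modulo the ideal, then \<open>f\<close> is congruent to a
  combination of one representative for each class, the coefficient being the sum of the
  coefficients over the class. So \<open>f\<close> lies in the ideal as soon as each class sum vanishes or its
  representative lies in the ideal. This is how membership in ideals generated by differences of
  monomials and by monomials is decided below.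
\<close>

lemma in_ideal_if_class_sums_vanish:
  fixes \<kappa> :: "('v \<Rightarrow>\<^sub>0 nat) \<Rightarrow> 'c"
  assumes f: "f \<in> carrier (poly_ring A)"
    and cong: "\<And>m m'. m \<in> Poly_Mapping.keys f \<Longrightarrow> m' \<in> Poly_Mapping.keys f \<Longrightarrow> \<kappa> m = \<kappa> m' \<Longrightarrow>
      Poly_Mapping.single m 1 - Poly_Mapping.single m' 1 \<in> J"
    and vanish: "\<And>m. m \<in> Poly_Mapping.keys f \<Longrightarrow> Poly_Mapping.single m 1 \<in> J \<or>
      (\<Sum>m'\<in>{m' \<in> Poly_Mapping.keys f. \<kappa> m' = \<kappa> m}. Poly_Mapping.lookup f m') = 0"
  shows "f \<in> J"
proof -
  let ?K = "Poly_Mapping.keys f" and ?c = "Poly_Mapping.lookup f"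
  let ?cls = "\<lambda>k. {m \<in> ?K. \<kappa> m = k}"
  let ?const = "\<lambda>c. Poly_Mapping.single 0 c :: ('v, 'k) mpoly"
  have const: "?const c \<in> carrier (poly_ring A)" for c by (simp add: poly_ring_closed)
  have "(\<Sum>m\<in>?cls k. Poly_Mapping.single m (?c m)) \<in> J" if k: "k \<in> \<kappa> ` ?K" for k
  proof -
    from k obtain m0 where m0: "m0 \<in> ?K" "k = \<kappa> m0" by auto
    have split: "Poly_Mapping.single m (?c m) =
        ?const (?c m) * (Poly_Mapping.single m 1 - Poly_Mapping.single m0 1) +
        ?const (?c m) * Poly_Mapping.single m0 1" for m
      by (simp add: right_diff_distrib mult_single)
    have "(\<Sum>m\<in>?cls k. ?const (?c m) * Poly_Mapping.single m0 1) =
        ?const (\<Sum>m\<in>?cls k. ?c m) * Poly_Mapping.single m0 1"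
      by (simp only: single_sum sum_distrib_right)
    also have "\<dots> \<in> J"
      using vanish[OF m0(1)] const poly_ideal_mult poly_ideal_zero m0(2) by auto
    finally have "(\<Sum>m\<in>?cls k. ?const (?c m) * Poly_Mapping.single m0 1) \<in> J" .
    moreover have "(\<Sum>m\<in>?cls k. ?const (?c m) *
        (Poly_Mapping.single m 1 - Poly_Mapping.single m0 1)) \<in> J"
      using cong m0 const by (intro poly_ideal_sum poly_ideal_mult) auto
    ultimately show ?thesis
      by (subst split) (simp add: sum.distrib poly_ideal_add)
  qed
  then have "(\<Sum>k\<in>\<kappa> ` ?K. \<Sum>m\<in>?cls k. Poly_Mapping.single m (?c m)) \<in> J"
    by (rule poly_ideal_sum)
  also have "(\<Sum>k\<in>\<kappa> ` ?K. \<Sum>m\<in>?cls k. Poly_Mapping.single m (?c m)) =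
      (\<Sum>m\<in>?K. Poly_Mapping.single m (?c m))"
    by (intro sum.group) auto
  finally show ?thesis by (simp flip: poly_mapping_eq_sum_single)
qed

end

lemma fbinom_eq_monomials:
  "fbinom i j x y =
     Poly_Mapping.single (Poly_Mapping.single (i, x) 1 + Poly_Mapping.single (j, y) 1) 1 -
     Poly_Mapping.single (Poly_Mapping.single (i, y) 1 + Poly_Mapping.single (j, x) 1) 1"
  by (simp add: fbinom_def pvar_def mult_single)

section \<open>Toric maps and congruence of monomials\<close>

definition monomials_congruent ::
    "('v, 'k::field) mpoly set \<Rightarrow> ('v \<Rightarrow>\<^sub>0 nat) \<Rightarrow> ('v \<Rightarrow>\<^sub>0 nat) \<Rightarrow> bool" where
  "monomials_congruent J m m' \<longleftrightarrow> Poly_Mapping.single m 1 - Poly_Mapping.single m' 1 \<in> J"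

text \<open>
  The toric map attached to \<open>Y\<close> sends \<open>p\<^bsub>ix\<^esub>\<close> with \<open>x \<in> Y\<close> to
  \<open>t\<^bsub>x\<^esub> s\<^bsub>iC\<^esub>\<close>, where \<open>C\<close> is the component of \<open>x\<close>, and the other variables to zero. The new variables \<open>t\<^bsub>x\<^esub>\<close> and
  \<open>s\<^bsub>iC\<^esub>\<close> are indexed by a sum type, which \<open>enc\<close> numbers by natural numbers: polynomials whose
  variables are linearly ordered are known to form an integral domain, and this is what makes the
  kernel prime.
\<close>

locale exponent_code =
  fixes X0 :: "'i set" and V :: "'x set" and enc :: "'x + 'i \<times> 'x set \<Rightarrow> nat"
  assumes finite_X0: "finite X0" and finite_V: "finite V"
    and inj_enc: "inj_on enc (Inl ` V \<union> Inr ` (X0 \<times> Pow V))"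
begin

text \<open>
  The exponent vector of the image of a monomial. It records, for each vertex \<open>x\<close>, the number of
  factors \<open>p\<^bsub>ix\<^esub>\<close> and, for each \<open>i\<close> and each class \<open>C\<close> of \<open>r\<close>, the number of factors
  \<open>p\<^bsub>ix\<^esub>\<close> with \<open>x \<in> C\<close>.
\<close>

definition weight :: "'x rel \<Rightarrow> ('i \<times> 'x \<Rightarrow>\<^sub>0 nat) \<Rightarrow> (nat \<Rightarrow>\<^sub>0 nat)" where
  "weight r m = push_on UNIV (\<lambda>(i, x). enc (Inl x)) m +
     push_on UNIV (\<lambda>(i, x). enc (Inr (i, r `` {x}))) m"

definition toric :: "'x set \<Rightarrow> 'x rel \<Rightarrow> ('i \<times> 'x, 'k::field) mpoly \<Rightarrow> (nat, 'k) mpoly" where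
  "toric Y r = push_on {m. Poly_Mapping.keys m \<subseteq> X0 \<times> Y} (weight r)"

lemma weight_0 [simp]: "weight r 0 = 0"
  by (simp add: weight_def)

lemma weight_add: "weight r (m + m') = weight r m + weight r m'"
  by (simp add: weight_def push_on_add ac_simps)

lemma weight_eq_0_iff: "weight r m = 0 \<longleftrightarrow> m = 0"
proof
  assume "weight r m = 0"
  then have "Poly_Mapping.keys (weight r m) = {}" by simp
  then have "Poly_Mapping.keys m = {}"
    unfolding weight_def keys_add_nat keys_push_on_nat by simp
  then show "m = 0" by simp
qed simp

text \<open>
  Exchanging two indices between vertices of the same class changes neither kind of count; hence
  the binomials of the component ideals lie in the kernel.
\<close>

lemma weight_swap:
  assumes "r `` {x} = r `` {y}"
  shows "weight r (Poly_Mapping.single (i, x) 1 + Poly_Mapping.single (j, y) 1) =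
    weight r (Poly_Mapping.single (i, y) 1 + Poly_Mapping.single (j, x) 1)"
  using assms by (simp add: weight_def push_on_add ac_simps)

text \<open>
  Since exponents are natural numbers, a variable occurring in the image of a monomial comes from
  one of its factors. Two monomials of equal weight therefore have factors at the same vertices,
  and a factor with index \<open>i\<close> in a class of the one has a counterpart in the other.
\<close>

context
  fixes Y :: "'x set" and r :: "'x rel" and u v :: "'i \<times> 'x \<Rightarrow>\<^sub>0 nat" and i x
  assumes Y: "Y \<subseteq> V" and r: "equiv Y r"
    and u: "Poly_Mapping.keys u \<subseteq> X0 \<times> Y" and v: "Poly_Mapping.keys v \<subseteq> X0 \<times> Y"
    and eq: "weight r u = weight r v" and ix: "(i, x) \<in> Poly_Mapping.keys u"
begin

lemma class_subset: "r `` {y} \<subseteq> V"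
  using equiv_type[OF r] Y by blast

lemma code_of_weight:
  assumes "c \<in> Inl ` V \<union> Inr ` (X0 \<times> Pow V)" and "enc c \<in> Poly_Mapping.keys (weight r v)"
  shows "\<exists>(j, y)\<in>Poly_Mapping.keys v. c = Inl y \<or> c = Inr (j, r `` {y})"
proof -
  from assms(2) obtain j y where jy: "(j, y) \<in> Poly_Mapping.keys v"
    and "enc c = enc (Inl y) \<or> enc c = enc (Inr (j, r `` {y}))"
    unfolding weight_def keys_add_nat keys_push_on_nat by auto
  moreover have "Inl y \<in> Inl ` V \<union> Inr ` (X0 \<times> Pow V)"
    "Inr (j, r `` {y}) \<in> Inl ` V \<union> Inr ` (X0 \<times> Pow V)"
    using jy v Y class_subset by blast+
  ultimately have "c = Inl y \<or> c = Inr (j, r `` {y})"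
    using inj_onD[OF inj_enc] assms(1) by metis
  with jy show ?thesis by blast
qed

lemma same_weight_same_vertex: "\<exists>j. (j, x) \<in> Poly_Mapping.keys v"
proof -
  have "enc (Inl x) \<in> Poly_Mapping.keys (weight r u)"
    using ix unfolding weight_def keys_add_nat keys_push_on_nat by force
  then show ?thesis unfolding eq using code_of_weight[of "Inl x"] ix u Y by fastforce
qed

lemma same_weight_same_class: "\<exists>y. (i, y) \<in> Poly_Mapping.keys v \<and> (x, y) \<in> r"
proof -
  have "enc (Inr (i, r `` {x})) \<in> Poly_Mapping.keys (weight r u)"
    using ix unfolding weight_def keys_add_nat keys_push_on_nat by force
  moreover have "Inr (i, r `` {x}) \<in> Inl ` V \<union> Inr ` (X0 \<times> Pow V)"
    using ix u class_subset by blast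
  ultimately obtain y where "(i, y) \<in> Poly_Mapping.keys v" "r `` {x} = r `` {y}"
    using code_of_weight unfolding eq by blast
  moreover from this have "y \<in> Y" using v by auto
  ultimately show ?thesis using eq_equiv_class[OF _ r] by blast
qed

end

lemma same_weight_same_support:
  assumes "Y \<subseteq> V" and "equiv Y r" and "Poly_Mapping.keys u \<subseteq> X0 \<times> Y"
    and "Poly_Mapping.keys v \<subseteq> X0 \<times> Y" and "weight r u = weight r v"
  shows "snd ` Poly_Mapping.keys u = snd ` Poly_Mapping.keys v"
  using same_weight_same_vertex[OF assms]
    same_weight_same_vertex[OF assms(1,2,4,3) assms(5)[symmetric]] by force

lemma toric_add: "toric Y r (p + q) = toric Y r p + toric Y r q"
  by (simp add: toric_def push_on_add)

lemma toric_diff: "toric Y r (p - q) = toric Y r p - toric Y r q"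
  by (simp add: toric_def push_on_diff)

lemma toric_mult: "toric Y r (p * q) = toric Y r p * toric Y r q"
  unfolding toric_def by (rule push_on_mult) (simp_all add: keys_add_nat weight_add)

lemma toric_1: "toric Y r 1 = 1"
  by (simp add: toric_def flip: single_one)

lemma toric_single:
  "toric Y r (Poly_Mapping.single m c) =
     (if Poly_Mapping.keys m \<subseteq> X0 \<times> Y then Poly_Mapping.single (weight r m) c else 0)"
  by (simp add: toric_def)

lemma toric_0: "toric Y r 0 = 0"
  by (simp add: toric_def)

lemma toric_power: "toric Y r (p ^ n) = toric Y r p ^ n"
  by (induction n) (simp_all add: toric_1 toric_mult)

lemma toric_prod: "toric Y r (\<Prod>s\<in>S. f s) = (\<Prod>s\<in>S. toric Y r (f s))"
  by (induction S rule: infinite_finite_induct) (simp_all add: toric_1 toric_mult)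

lemma toric_pvar_eq_0_iff:
  assumes "i \<in> X0"
  shows "toric Y r (pvar i x :: ('i \<times> 'x, 'k::field) mpoly) = 0 \<longleftrightarrow> x \<notin> Y"
  using assms by (auto simp: pvar_def toric_single)

lemma toric_fbinom_eq_0:
  assumes "x \<in> Y \<Longrightarrow> y \<in> Y \<Longrightarrow> r `` {x} = r `` {y}"
  shows "toric Y r (fbinom i j x y :: ('i \<times> 'x, 'k::field) mpoly) = 0"
  using weight_swap[of r x y i j] assms
  by (auto simp: fbinom_eq_monomials toric_diff toric_single keys_add_nat)

text \<open>
  The first term of the binomial has a factor with index \<open>i\<close> in the class of \<open>x\<close>; the second
  has it in the class of \<open>y\<close>. So the two terms have different images.
\<close>

lemma toric_fbinom_neq_0:
  assumes Y: "Y \<subseteq> V" and r: "equiv Y r" and ij: "i \<in> X0" "j \<in> X0" "i \<noteq> j"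
    and xy: "x \<in> Y" "y \<in> Y" "(x, y) \<notin> r"
  shows "toric Y r (fbinom i j x y :: ('i \<times> 'x, 'k::field) mpoly) \<noteq> 0"
proof
  let ?u = "Poly_Mapping.single (i, x) 1 + Poly_Mapping.single (j, y) 1 :: 'i \<times> 'x \<Rightarrow>\<^sub>0 nat"
  let ?v = "Poly_Mapping.single (i, y) 1 + Poly_Mapping.single (j, x) 1 :: 'i \<times> 'x \<Rightarrow>\<^sub>0 nat"
  have keys: "Poly_Mapping.keys ?u = {(i, x), (j, y)}" "Poly_Mapping.keys ?v = {(i, y), (j, x)}"
    by (auto simp: keys_add_nat)
  assume "toric Y r (fbinom i j x y :: ('i \<times> 'x, 'k) mpoly) = 0"
  then have "Poly_Mapping.single (weight r ?u) (1::'k) = Poly_Mapping.single (weight r ?v) 1"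
    using ij xy by (simp add: fbinom_eq_monomials toric_diff toric_single keys_add_nat)
  then have "weight r ?u = weight r ?v"
    by (metis keys_single singleton_inject zero_neq_one)
  then have "\<exists>z. (i, z) \<in> Poly_Mapping.keys ?v \<and> (x, z) \<in> r"
    using same_weight_same_class[OF Y r, of ?u ?v i x] ij xy unfolding keys by auto
  then show False using ij xy unfolding keys by auto
qed

definition toric_kernel :: "'x set \<Rightarrow> 'x rel \<Rightarrow> ('i \<times> 'x, 'k::field) mpoly set" where
  "toric_kernel Y r = {p \<in> carrier (poly_ring (X0 \<times> V)). toric Y r p = 0}"

lemma ideal_toric_kernel:
  "ideal (toric_kernel Y r :: ('i \<times> 'x, 'k::field) mpoly set) (poly_ring (X0 \<times> V))"
proof -
  interpret R: cring "poly_ring (X0 \<times> V) :: ('i \<times> 'x, 'k) mpoly ring" by (rule cring_poly_ring)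
  show ?thesis
  proof (rule idealI)
    show "subgroup (toric_kernel Y r) (add_monoid (poly_ring (X0 \<times> V) :: ('i \<times> 'x, 'k) mpoly ring))"
    proof (rule R.add.subgroupI)
      fix p :: "('i \<times> 'x, 'k) mpoly" assume p: "p \<in> toric_kernel Y r"
      then have "- p \<in> toric_kernel Y r"
        using toric_diff[of Y r 0 p] by (simp add: toric_kernel_def poly_ring_closed toric_0)
      moreover have "\<ominus>\<^bsub>poly_ring (X0 \<times> V)\<^esub> p = - p"
        using p by (intro R.minus_equality) (auto simp: toric_kernel_def poly_ring_closed)
      ultimately show "\<ominus>\<^bsub>poly_ring (X0 \<times> V)\<^esub> p \<in> toric_kernel Y r" by simp
    qed (auto simp: toric_kernel_def poly_ring_closed toric_add toric_0 intro!: exI[of _ 0])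
  qed (auto simp: toric_kernel_def poly_ring_closed toric_mult R.ring_axioms)
qed

lemma radical_toric_kernel:
  "radical (poly_ring (X0 \<times> V)) (toric_kernel Y r :: ('i \<times> 'x, 'k::field) mpoly set) = toric_kernel Y r"
proof
  show "radical (poly_ring (X0 \<times> V)) (toric_kernel Y r :: ('i \<times> 'x, 'k) mpoly set) \<subseteq> toric_kernel Y r"
    by (auto simp: radical_def toric_kernel_def poly_ring_nat_pow toric_power)
  show "(toric_kernel Y r :: ('i \<times> 'x, 'k) mpoly set) \<subseteq> radical (poly_ring (X0 \<times> V)) (toric_kernel Y r)"
    by (auto simp: radical_def toric_kernel_def poly_ring_nat_pow intro!: exI[of _ 1])
qed

lemma primary_toric_kernel:
  "primary_ideal (toric_kernel Y r :: ('i \<times> 'x, 'k::field) mpoly set) (poly_ring (X0 \<times> V))"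
proof -
  have "(1 :: ('i \<times> 'x, 'k) mpoly) \<notin> toric_kernel Y r" by (simp add: toric_kernel_def toric_1)
  then have "toric_kernel Y r \<noteq> carrier (poly_ring (X0 \<times> V) :: ('i \<times> 'x, 'k) mpoly ring)"
    using poly_ring_closed(2)[where ?'k = 'k] by blast
  then show ?thesis
    unfolding primary_ideal_def radical_toric_kernel
    using ideal_toric_kernel by (auto simp: toric_kernel_def toric_mult)
qed

text \<open>
  A monomial is seen as a configuration of tokens: a factor \<open>p\<^bsub>ix\<^esub>\<close> is a token labelled \<open>i\<close> at the
  vertex \<open>x\<close>. Modulo an ideal that contains the binomials of \<open>E'\<close>, tokens at the two ends of an
  edge of \<open>E'\<close> may be exchanged.
\<close>

context
  fixes J :: "('i \<times> 'x, 'k::field) mpoly set" and E' :: "'x rel"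
  assumes J: "ideal J (poly_ring (X0 \<times> V))"
    and gens: "\<And>i j x y. i \<in> X0 \<Longrightarrow> j \<in> X0 \<Longrightarrow> (x, y) \<in> E' \<Longrightarrow> fbinom i j x y \<in> J"
begin

lemma congruent_refl: "monomials_congruent J m m"
  by (simp add: monomials_congruent_def poly_ideal_zero[OF J])

lemma congruent_trans [trans]: "monomials_congruent J m m' \<Longrightarrow> monomials_congruent J m' m'' \<Longrightarrow> monomials_congruent J m m''"
  unfolding monomials_congruent_def by (drule (1) poly_ideal_add[OF J]) simp

lemma swap_along_edge:
  assumes "Poly_Mapping.keys u \<subseteq> X0 \<times> V" and "i \<in> X0" and "j \<in> X0" and "(x, y) \<in> E'"
  shows "monomials_congruent J (u + Poly_Mapping.single (i, x) 1 + Poly_Mapping.single (j, y) 1)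
     (u + Poly_Mapping.single (i, y) 1 + Poly_Mapping.single (j, x) 1)"
proof -
  have "Poly_Mapping.single u 1 * fbinom i j x y \<in> J"
    using assms gens by (intro poly_ideal_mult[OF J]) (auto simp: poly_ring_closed)
  then show ?thesis
    by (simp add: monomials_congruent_def fbinom_eq_monomials right_diff_distrib mult_single add.assoc)
qed

text \<open>
  If every vertex of \<open>W\<close> carries a token, the tokens at the ends of a path in \<open>W\<close> can be exchanged:
  for the last edge \<open>(z, y)\<close> of the path, with a token \<open>k\<close> at \<open>z\<close>, exchange \<open>k\<close> with \<open>j\<close>, then
  \<open>j\<close> with \<open>i\<close> along the shorter path from \<open>x\<close> to \<open>z\<close>, and finally \<open>i\<close> with \<open>k\<close>. The set of
  occupied vertices stays the same throughout.
\<close>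

lemma swap_along_path:
  assumes "(x, y) \<in> rtrancl_on W E'"
    and "Poly_Mapping.keys u \<subseteq> X0 \<times> V" and "i \<in> X0" and "j \<in> X0" and "W \<subseteq> V"
    and "W \<subseteq> snd ` Poly_Mapping.keys (u + Poly_Mapping.single (i, x) 1 + Poly_Mapping.single (j, y) 1)"
  shows "monomials_congruent J (u + Poly_Mapping.single (i, x) 1 + Poly_Mapping.single (j, y) 1)
     (u + Poly_Mapping.single (i, y) 1 + Poly_Mapping.single (j, x) 1)"
  using assms
proof (induction arbitrary: u i j rule: rtrancl_on_induct)
  case base
  then show ?case by (simp add: congruent_refl)
next
  case (step z y)
  let ?e = "\<lambda>i x. Poly_Mapping.single (i, x) (1::nat)"
  consider "x = y" | "z = x" | "z = y" | "z \<noteq> x" "z \<noteq> y" by blast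
  then show ?case
  proof cases
    case 1
    then show ?thesis by (simp add: congruent_refl)
  next
    case 2
    then show ?thesis using step swap_along_edge by auto
  next
    case 3
    then show ?thesis using step by auto
  next
    case 4
    have "z \<in> snd ` Poly_Mapping.keys (u + ?e i x + ?e j y)" using step by auto
    then obtain k where k: "(k, z) \<in> Poly_Mapping.keys u" using 4 by (auto simp: keys_add_nat)
    then obtain u' where u': "u = u' + ?e k z" by (rule split_off_variable)
    have "k \<in> X0" and sub: "Poly_Mapping.keys u' \<subseteq> X0 \<times> V" and "x \<in> V" "y \<in> V" "z \<in> V"
      using k step.prems step.hyps u' in_rtrancl_on_in_F[OF step.hyps(1)]
      by (auto simp: keys_add_nat)
    have "monomials_congruent J (u + ?e i x + ?e j y) ((u' + ?e k y) + ?e i x + ?e j z)"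
      using swap_along_edge[of "u' + ?e i x" k j z y] step \<open>k \<in> X0\<close> sub \<open>x \<in> V\<close>
      by (simp add: u' keys_add_nat ac_simps)
    also have "monomials_congruent J \<dots> ((u' + ?e k y) + ?e i z + ?e j x)"
      using step.prems \<open>k \<in> X0\<close> sub \<open>y \<in> V\<close>
      by (intro step.IH) (auto simp: u' keys_add_nat)
    also have "monomials_congruent J \<dots> (u + ?e i y + ?e j x)"
      using swap_along_edge[of "u' + ?e j x" i k z y] step \<open>k \<in> X0\<close> sub \<open>x \<in> V\<close>
      by (simp add: u' keys_add_nat ac_simps)
    finally show ?thesis .
  qed
qed

text \<open>
  Configurations of equal weight have the same number of tokens at each vertex and the same
  supply of labels in each class. If the classes are connected through occupied vertices, each
  label can be brought to its place by exchanges. The common part \<open>w\<close> collects the tokens that are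
  already in place; it is kept because removing them could leave vertices empty and so disconnect
  the paths.
\<close>

lemma same_weight_imp_cong:
  assumes "Y \<subseteq> V" and "equiv Y r"
    and "Poly_Mapping.keys (u + w) \<subseteq> X0 \<times> Y" and "Poly_Mapping.keys (v + w) \<subseteq> X0 \<times> Y"
    and "weight r u = weight r v" and "W = snd ` Poly_Mapping.keys (u + w)"
    and "r \<inter> W \<times> W \<subseteq> rtrancl_on W E'"
  shows "monomials_congruent J (u + w) (v + w)"
  using assms(3-)
proof (induction u arbitrary: v w rule: monomial_induct)
  case one
  then have "v = 0" using weight_eq_0_iff by simp
  then show ?case by (simp add: congruent_refl)
next
  case (times_variable u ix)
  let ?e = "\<lambda>i x. Poly_Mapping.single (i, x) (1::nat)"
  obtain i x where ix: "ix = (i, x)" by fastforce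
  have keys: "Poly_Mapping.keys (u + ?e i x) \<subseteq> X0 \<times> Y" "Poly_Mapping.keys v \<subseteq> X0 \<times> Y"
    "(i, x) \<in> Poly_Mapping.keys (u + ?e i x)"
    using times_variable.prems ix by (auto simp: keys_add_nat)
  have wt: "weight r (u + ?e i x) = weight r v" using times_variable.prems ix by simp
  obtain j where j: "(j, x) \<in> Poly_Mapping.keys v"
    using same_weight_same_vertex[OF assms(1,2) keys(1,2) wt keys(3)] by blast
  obtain y where y: "(i, y) \<in> Poly_Mapping.keys v" "(x, y) \<in> r"
    using same_weight_same_class[OF assms(1,2) keys(1,2) wt keys(3)] by blast
  have "W = snd ` Poly_Mapping.keys (u + ?e i x) \<union> snd ` Poly_Mapping.keys w"
    using times_variable.prems(4) ix by (simp only: keys_add_nat image_Un)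
  then have supp: "W = snd ` Poly_Mapping.keys (v + w)"
    unfolding same_weight_same_support[OF assms(1,2) keys(1,2) wt]
    by (simp only: keys_add_nat image_Un)
  \<comment> \<open>Once \<open>v\<close> has a token \<open>i\<close> at \<open>x\<close>, this token moves to the common part.\<close>
  have step: "monomials_congruent J ((u + ?e i x) + w) (v' + ?e i x + w)"
    if "Poly_Mapping.keys v' \<subseteq> X0 \<times> Y" and "weight r (v' + ?e i x) = weight r v" for v'
  proof -
    have "weight r u = weight r v'"
      using that(2) wt by (metis add_right_cancel weight_add)
    then have "monomials_congruent J (u + (w + ?e i x)) (v' + (w + ?e i x))"
      using that(1) times_variable.prems unfolding ix
      by (intro times_variable.IH) (auto simp: keys_add_nat ac_simps)
    then show ?thesis by (simp add: ac_simps)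
  qed
  show ?case
  proof (cases "(i, x) \<in> Poly_Mapping.keys v")
    case True
    then obtain v' where v': "v = v' + ?e i x" by (rule split_off_variable)
    then show ?thesis using step[of v'] keys(2) ix by (simp add: keys_add_nat)
  next
    case False
    from j obtain v1 where v1: "v = v1 + ?e j x" by (rule split_off_variable)
    with y False have "(i, y) \<in> Poly_Mapping.keys v1" by (auto simp: keys_add_nat)
    then obtain v' where v': "v1 = v' + ?e i y" by (rule split_off_variable)
    have ins: "Poly_Mapping.keys v' \<subseteq> X0 \<times> Y" "i \<in> X0" "j \<in> X0" "x \<in> Y" "y \<in> Y" "x \<in> W" "y \<in> W"
      using keys(2) v1 v' j y supp by (auto simp: keys_add_nat)
    have "weight r (v' + ?e j y + ?e i x) = weight r v"
      using weight_swap[of r x y i j] equiv_class_eq[OF assms(2) y(2)]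
      by (simp add: v1 v' weight_add ac_simps)
    \<comment> \<open>Exchanging the token \<open>i\<close> at \<open>y\<close> with the token \<open>j\<close> at \<open>x\<close> brings \<open>i\<close> into place.\<close>
    then have "monomials_congruent J ((u + ?e i x) + w) (v' + ?e j y + ?e i x + w)"
      using ins by (intro step) (auto simp: keys_add_nat)
    also have "\<dots> = (v' + w) + ?e i x + ?e j y" by (simp add: ac_simps)
    also have "monomials_congruent J \<dots> ((v' + w) + ?e i y + ?e j x)"
    proof (rule swap_along_path)
      show "(x, y) \<in> rtrancl_on W E'" using times_variable.prems(5) y(2) ins by auto
      show "W \<subseteq> V" using times_variable.prems assms(1) by auto
      show "Poly_Mapping.keys (v' + w) \<subseteq> X0 \<times> V"
        using ins(1) times_variable.prems assms(1) by (auto simp: keys_add_nat)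
      show "W \<subseteq> snd ` Poly_Mapping.keys ((v' + w) + ?e i x + ?e j y)"
        unfolding supp v1 v' by (auto simp: keys_add_nat)
    qed (use ins in auto)
    also have "\<dots> = v + w" by (simp add: v1 v' ac_simps)
    finally show ?thesis by (simp add: ix)
  qed
qed

end

end

section \<open>The decomposition of the binomial edge ideal\<close>

context exponent_code
begin

context
  fixes G :: "'x pair_pre_digraph"
  assumes graph: "pair_graph G" and verts: "pverts G = V"
begin

abbreviation conn :: "'x set \<Rightarrow> 'x rel" where
  "conn Y \<equiv> rtrancl_on Y (parcs G)"

abbreviation kernel_ideal :: "'x set \<Rightarrow> ('i \<times> 'x, 'k::field) mpoly set" where
  "kernel_ideal Y \<equiv> toric_kernel Y (conn Y)"

lemma sym_parcs: "sym (parcs G)"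
proof -
  interpret pair_graph G by (rule graph)
  show ?thesis using sym_arcs by (simp add: symmetric_def)
qed

lemma equiv_conn: "equiv Y (conn Y)"
  using sym_parcs by (rule rtrancl_on_equiv)

lemma parcs_verts: "(x, y) \<in> parcs G \<Longrightarrow> x \<in> V \<and> y \<in> V"
proof -
  interpret pair_graph G by (rule graph)
  show "(x, y) \<in> parcs G \<Longrightarrow> x \<in> V \<and> y \<in> V"
    using in_arcsD1 in_arcsD2 verts by auto
qed

lemma fbinom_in_kernel_ideal:
  assumes "i \<in> X0" and "j \<in> X0" and "x \<in> V" and "y \<in> V"
    and "x \<in> Y \<Longrightarrow> y \<in> Y \<Longrightarrow> (x, y) \<in> conn Y"
  shows "(fbinom i j x y :: ('i \<times> 'x, 'k::field) mpoly) \<in> kernel_ideal Y"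
proof -
  have "(fbinom i j x y :: ('i \<times> 'x, 'k) mpoly) \<in> carrier (poly_ring (X0 \<times> V))"
    unfolding fbinom_eq_monomials using assms by (intro poly_ring_closed) (auto simp: keys_add_nat)
  then show ?thesis
    using assms(5) equiv_class_eq[OF equiv_conn] by (simp add: toric_kernel_def toric_fbinom_eq_0)
qed

text \<open>
  The generators are killed by the toric map. Conversely, a monomial with a vertex outside \<open>Y\<close> is
  a multiple of a generator, and two monomials on \<open>Y\<close> with the same image are congruent because
  tokens can be exchanged directly within each component of \<open>Y\<close>. As all monomials with one
  image form a class, the class sums of an element of the kernel are coefficients of its image,
  which is zero.
\<close>

lemma component_ideal_eq_kernel_ideal:
  assumes "Y \<subseteq> V"
  shows "(component_ideal X0 G Y :: ('i \<times> 'x, 'k::field) mpoly set) = kernel_ideal Y"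
proof
  let ?R = "poly_ring (X0 \<times> V) :: ('i \<times> 'x, 'k) mpoly ring"
  let ?J = "component_ideal X0 G Y :: ('i \<times> 'x, 'k) mpoly set"
  interpret R: cring ?R by (rule cring_poly_ring)
  define S where "S = ({pvar i x | i x. i \<in> X0 \<and> x \<in> V - Y} \<union>
        {fbinom i j x y | i j x y. i \<in> X0 \<and> j \<in> X0 \<and> x \<in> Y \<and> y \<in> Y \<and> (x, y) \<in> conn Y}
      :: ('i \<times> 'x, 'k) mpoly set)"
  have J_eq: "?J = Idl\<^bsub>?R\<^esub> S"
    using assms unfolding component_ideal_def S_def verts
    by (simp add: connected_in_induced_iff[OF graph] verts)
  have S: "S \<subseteq> kernel_ideal Y"
  proof
    fix p assume "p \<in> S"
    then consider i x where "p = pvar i x" "i \<in> X0" "x \<in> V - Y"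
      | i j x y where "p = fbinom i j x y" "i \<in> X0" "j \<in> X0" "x \<in> Y" "y \<in> Y" "(x, y) \<in> conn Y"
      unfolding S_def by blast
    then show "p \<in> kernel_ideal Y"
    proof cases
      case 1
      then have "pvar i x \<in> carrier ?R" unfolding pvar_def by (intro poly_ring_closed) auto
      with 1 show ?thesis by (simp add: toric_kernel_def toric_pvar_eq_0_iff)
    next
      case 2
      then show ?thesis using fbinom_in_kernel_ideal assms by blast
    qed
  qed
  show "?J \<subseteq> kernel_ideal Y"
    unfolding J_eq using ideal_toric_kernel S by (rule R.genideal_minimal)
  have S_carrier: "S \<subseteq> carrier ?R" using S by (auto simp: toric_kernel_def)
  then have J: "ideal ?J ?R" unfolding J_eq by (rule R.genideal_ideal)
  have SJ: "S \<subseteq> ?J" unfolding J_eq using S_carrier by (rule R.genideal_self)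
  have "pvar i x \<in> S" if "i \<in> X0" "x \<in> V - Y" for i x
    unfolding S_def using that by blast
  then have pvar_J: "pvar i x \<in> ?J" if "i \<in> X0" "x \<in> V - Y" for i x
    using SJ that by (meson subsetD)
  have "fbinom i j x y \<in> S" if "i \<in> X0" "j \<in> X0" "(x, y) \<in> conn Y" for i j x y
    unfolding S_def using that in_rtrancl_on_in_F[OF that(3)] by blast
  then have fbinom_J: "fbinom i j x y \<in> ?J" if "i \<in> X0" "j \<in> X0" "(x, y) \<in> conn Y" for i j x y
    using SJ that by (meson subsetD)
  show "kernel_ideal Y \<subseteq> ?J"
  proof
    fix f :: "('i \<times> 'x, 'k) mpoly" assume f: "f \<in> kernel_ideal Y"
    let ?\<kappa> = "\<lambda>m. if Poly_Mapping.keys m \<subseteq> X0 \<times> Y then Some (weight (conn Y) m) else None"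
    have f_vars: "Poly_Mapping.keys m \<subseteq> X0 \<times> V" if "m \<in> Poly_Mapping.keys f" for m
      using f that by (auto simp: toric_kernel_def carrier_poly_ring)
    have outside: "Poly_Mapping.single m 1 \<in> ?J"
      if m: "m \<in> Poly_Mapping.keys f" "\<not> Poly_Mapping.keys m \<subseteq> X0 \<times> Y" for m
    proof -
      obtain i x where ix: "(i, x) \<in> Poly_Mapping.keys m" "i \<in> X0" "x \<in> V - Y"
        using m f_vars by blast
      then obtain m' where m': "m = m' + Poly_Mapping.single (i, x) 1"
        by (auto elim: split_off_variable)
      have "pvar i x \<in> ?J" using pvar_J ix by simp
      moreover have "(Poly_Mapping.single m' 1 :: ('i \<times> 'x, 'k) mpoly) \<in> carrier ?R"
        using f_vars[OF m(1)] unfolding m' by (intro poly_ring_closed) (auto simp: keys_add_nat)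
      ultimately have "Poly_Mapping.single m' 1 * pvar i x \<in> ?J"
        by (rule poly_ideal_mult[OF J])
      then show ?thesis by (simp add: m' pvar_def mult_single)
    qed
    show "f \<in> ?J"
    proof (rule in_ideal_if_class_sums_vanish[OF J, where \<kappa> = ?\<kappa>])
      show "f \<in> carrier ?R" using f by (simp add: toric_kernel_def)
    next
      fix m m' assume m: "m \<in> Poly_Mapping.keys f" "m' \<in> Poly_Mapping.keys f" "?\<kappa> m = ?\<kappa> m'"
      show "Poly_Mapping.single m 1 - Poly_Mapping.single m' 1 \<in> ?J"
      proof (cases "Poly_Mapping.keys m \<subseteq> X0 \<times> Y")
        case True
        with m have "Poly_Mapping.keys m' \<subseteq> X0 \<times> Y" "weight (conn Y) m = weight (conn Y) m'"
          by (auto split: if_splits)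
        moreover have "conn Y \<inter> W \<times> W \<subseteq> rtrancl_on W (conn Y)" for W
          by (auto intro: rtrancl_on_into_rtrancl_on)
        ultimately have "monomials_congruent ?J (m + 0) (m' + 0)"
          using True
          by (intro same_weight_imp_cong[where E' = "conn Y", OF J fbinom_J assms equiv_conn]) auto
        then show ?thesis by (simp add: monomials_congruent_def)
      next
        case False
        with m have "\<not> Poly_Mapping.keys m' \<subseteq> X0 \<times> Y" by (auto split: if_splits)
        with False m outside show ?thesis by (intro poly_ideal_diff[OF J]) auto
      qed
    next
      fix m assume m: "m \<in> Poly_Mapping.keys f"
      show "Poly_Mapping.single m 1 \<in> ?J \<or>
        (\<Sum>m'\<in>{m' \<in> Poly_Mapping.keys f. ?\<kappa> m' = ?\<kappa> m}. Poly_Mapping.lookup f m') = 0"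
      proof (cases "Poly_Mapping.keys m \<subseteq> X0 \<times> Y")
        case True
        then have "(\<Sum>m'\<in>{m' \<in> Poly_Mapping.keys f. ?\<kappa> m' = ?\<kappa> m}. Poly_Mapping.lookup f m') =
            Poly_Mapping.lookup (toric Y (conn Y) f) (weight (conn Y) m)"
          unfolding toric_def lookup_push_on by (intro sum.cong) (auto split: if_splits)
        with f show ?thesis by (simp add: toric_kernel_def)
      next
        case False
        with m outside show ?thesis by blast
      qed
    qed
  qed
qed

lemma edge_binomial_in_kernel_ideal:
  assumes "i \<in> X0" and "j \<in> X0" and "(x, y) \<in> parcs G"
  shows "fbinom i j x y \<in> kernel_ideal Y"
  using assms parcs_verts[OF assms(3)]
  by (intro fbinom_in_kernel_ideal) (auto intro: rtrancl_on_into_rtrancl_on)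

text \<open>
  The binomials of the larger set \<open>Y\<close> between two vertices of \<open>W\<close> are binomials of \<open>W\<close> by the
  condition on connectedness; all others have a vertex outside \<open>W\<close> in each term.
\<close>

lemma kernel_ideal_mono:
  assumes "W \<subseteq> Y" and "Y \<subseteq> V" and "conn Y \<inter> W \<times> W \<subseteq> conn W"
  shows "(kernel_ideal Y :: ('i \<times> 'x, 'k::field) mpoly set) \<subseteq> kernel_ideal W"
proof -
  interpret R: cring "poly_ring (X0 \<times> V) :: ('i \<times> 'x, 'k) mpoly ring" by (rule cring_poly_ring)
  have "component_ideal X0 G Y \<subseteq> (kernel_ideal W :: ('i \<times> 'x, 'k) mpoly set)"
    unfolding component_ideal_def verts
  proof (rule R.genideal_minimal[OF ideal_toric_kernel], safe)
    fix i x assume ix: "i \<in> X0" "x \<in> V" "x \<notin> Y"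
    then have "(pvar i x :: ('i \<times> 'x, 'k) mpoly) \<in> carrier (poly_ring (X0 \<times> V))"
      unfolding pvar_def by (intro poly_ring_closed) auto
    then show "(pvar i x :: ('i \<times> 'x, 'k) mpoly) \<in> kernel_ideal W"
      using ix assms by (auto simp: toric_kernel_def toric_pvar_eq_0_iff)
  next
    fix i j x y
    assume "i \<in> X0" "j \<in> X0" "x \<in> Y" "y \<in> Y" "connected_in (with_proj G \<restriction> Y) x y"
    then show "(fbinom i j x y :: ('i \<times> 'x, 'k) mpoly) \<in> kernel_ideal W"
      using assms connected_in_induced_iff[OF graph, of Y x y] verts
      by (intro fbinom_in_kernel_ideal) auto
  qed
  then show ?thesis using component_ideal_eq_kernel_ideal[OF assms(2)] by metis
qed

text \<open>
  Group the monomials of \<open>f\<close> by the set \<open>W\<close> of vertices they occupy and by their weight with respect to the components of \<open>W\<close>. Monomials of one group are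
  congruent modulo the binomial edge ideal: every vertex of \<open>W\<close> carries a token, so tokens can
  travel along the edges of \<open>G\<close> in \<open>W\<close>. The weight determines the occupied vertices, so the sum of
  the coefficients over a group is a coefficient of the toric image of \<open>f\<close> for this \<open>W\<close>, which is
  zero because \<open>f\<close> lies in the kernel for \<open>W\<close>.
\<close>

lemma binomial_edge_ideal_eq_Inter_all:
  "(binomial_edge_ideal X0 G :: ('i \<times> 'x, 'k::field) mpoly set) = (\<Inter>W\<in>Pow V. kernel_ideal W)"
proof
  let ?R = "poly_ring (X0 \<times> V) :: ('i \<times> 'x, 'k) mpoly ring"
  let ?J = "binomial_edge_ideal X0 G :: ('i \<times> 'x, 'k) mpoly set"
  interpret R: cring ?R by (rule cring_poly_ring)
  define S where "S = ({fbinom i j x y | i j x y. i \<in> X0 \<and> j \<in> X0 \<and> (x, y) \<in> parcs G}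
    :: ('i \<times> 'x, 'k) mpoly set)"
  have J_eq: "?J = Idl\<^bsub>?R\<^esub> S"
    unfolding binomial_edge_ideal_def S_def verts ..
  have S: "S \<subseteq> kernel_ideal W" for W
    unfolding S_def using edge_binomial_in_kernel_ideal by blast
  then show "?J \<subseteq> (\<Inter>W\<in>Pow V. kernel_ideal W)"
    unfolding J_eq using R.genideal_minimal[OF ideal_toric_kernel] by blast
  have S_carrier: "S \<subseteq> carrier ?R" using S by (auto simp: toric_kernel_def)
  then have J: "ideal ?J ?R" unfolding J_eq by (rule R.genideal_ideal)
  have SJ: "S \<subseteq> ?J" unfolding J_eq using S_carrier by (rule R.genideal_self)
  have "fbinom i j x y \<in> S" if "i \<in> X0" "j \<in> X0" "(x, y) \<in> parcs G" for i j x y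
    unfolding S_def using that by blast
  then have fbinom_J: "fbinom i j x y \<in> ?J" if "i \<in> X0" "j \<in> X0" "(x, y) \<in> parcs G" for i j x y
    using SJ that by (meson subsetD)
  show "(\<Inter>W\<in>Pow V. kernel_ideal W) \<subseteq> ?J"
  proof
    fix f :: "('i \<times> 'x, 'k) mpoly" assume f: "f \<in> (\<Inter>W\<in>Pow V. kernel_ideal W)"
    let ?W = "\<lambda>m :: 'i \<times> 'x \<Rightarrow>\<^sub>0 nat. snd ` Poly_Mapping.keys m"
    let ?\<kappa> = "\<lambda>m. (?W m, weight (conn (?W m)) m)"
    have f_carrier: "f \<in> carrier ?R" using f by (auto simp: toric_kernel_def)
    have vars: "Poly_Mapping.keys m \<subseteq> X0 \<times> ?W m" "?W m \<subseteq> V" if "m \<in> Poly_Mapping.keys f" for m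
      using f_carrier that unfolding carrier_poly_ring by force+
    show "f \<in> ?J"
    proof (rule in_ideal_if_class_sums_vanish[OF J f_carrier, where \<kappa> = ?\<kappa>])
      fix m m' assume m: "m \<in> Poly_Mapping.keys f" "m' \<in> Poly_Mapping.keys f" "?\<kappa> m = ?\<kappa> m'"
      have "monomials_congruent ?J (m + 0) (m' + 0)"
        using m vars[OF m(1)] vars[OF m(2)]
        by (intro same_weight_imp_cong[where E' = "parcs G", OF J fbinom_J vars(2)[OF m(1)] equiv_conn]) auto
      then show "Poly_Mapping.single m 1 - Poly_Mapping.single m' 1 \<in> ?J"
        by (simp add: monomials_congruent_def)
    next
      fix m assume m: "m \<in> Poly_Mapping.keys f"
      have "?\<kappa> m' = ?\<kappa> m \<longleftrightarrow> Poly_Mapping.keys m' \<subseteq> X0 \<times> ?W m \<and>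
          weight (conn (?W m)) m' = weight (conn (?W m)) m" if "m' \<in> Poly_Mapping.keys f" for m'
        using vars(1)[OF that] vars[OF m] same_weight_same_support[OF vars(2)[OF m] equiv_conn, of m' m]
        by auto
      then have "(\<Sum>m'\<in>{m' \<in> Poly_Mapping.keys f. ?\<kappa> m' = ?\<kappa> m}. Poly_Mapping.lookup f m') =
          Poly_Mapping.lookup (toric (?W m) (conn (?W m)) f) (weight (conn (?W m)) m)"
        unfolding toric_def lookup_push_on mem_Collect_eq
        by (intro sum.cong refl Collect_cong conj_cong)
      also have "\<dots> = 0" using f vars(2)[OF m] by (auto simp: toric_kernel_def)
      finally show "Poly_Mapping.single m 1 \<in> ?J \<or>
        (\<Sum>m'\<in>{m' \<in> Poly_Mapping.keys f. ?\<kappa> m' = ?\<kappa> m}. Poly_Mapping.lookup f m') = 0" ..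
    qed
  qed
qed

text \<open>
  By \<open>joining_superset\<close> and \<open>kernel_ideal_mono\<close>, the kernel for any \<open>W\<close> contains the
  kernel for some separating set, so the other kernels can be dropped from the intersection.
\<close>

lemma binomial_edge_ideal_eq_Inter_separating:
  "(binomial_edge_ideal X0 G :: ('i \<times> 'x, 'k::field) mpoly set) =
     carrier (poly_ring (X0 \<times> V)) \<inter> (\<Inter>Y\<in>{Y. Y \<subseteq> V \<and> separating G Y}. component_ideal X0 G Y)"
proof -
  let ?S = "{Y. Y \<subseteq> V \<and> separating G Y}"
  have below: "\<exists>Y\<in>?S. (kernel_ideal Y :: ('i \<times> 'x, 'k) mpoly set) \<subseteq> kernel_ideal W"
    if W: "W \<subseteq> V" for W
  proof -
    obtain Y where Y: "W \<subseteq> Y" "Y \<subseteq> V" "\<forall>x\<in>V - Y. joins_components (parcs G) Y x"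
        "conn Y \<inter> W \<times> W \<subseteq> conn W"
      using joining_superset[OF finite_V sym_parcs W] .
    then have "Y \<in> ?S" using separating_iff_joins_components[OF graph, of Y] verts by simp
    then show ?thesis using kernel_ideal_mono[OF Y(1,2,4)] by (rule bexI[rotated])
  qed
  have "(\<Inter>W\<in>Pow V. kernel_ideal W) =
      (carrier (poly_ring (X0 \<times> V)) \<inter> (\<Inter>Y\<in>?S. kernel_ideal Y) :: ('i \<times> 'x, 'k) mpoly set)"
  proof
    show "(\<Inter>W\<in>Pow V. kernel_ideal W) \<subseteq>
        (carrier (poly_ring (X0 \<times> V)) \<inter> (\<Inter>Y\<in>?S. kernel_ideal Y) :: ('i \<times> 'x, 'k) mpoly set)"
      by (auto simp: toric_kernel_def)
    show "(carrier (poly_ring (X0 \<times> V)) \<inter> (\<Inter>Y\<in>?S. kernel_ideal Y) :: ('i \<times> 'x, 'k) mpoly set)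
        \<subseteq> (\<Inter>W\<in>Pow V. kernel_ideal W)"
    proof
      fix f :: "('i \<times> 'x, 'k) mpoly"
      assume f: "f \<in> carrier (poly_ring (X0 \<times> V)) \<inter> (\<Inter>Y\<in>?S. kernel_ideal Y)"
      show "f \<in> (\<Inter>W\<in>Pow V. kernel_ideal W)"
      proof
        fix W assume "W \<in> Pow V"
        then obtain Y where "Y \<in> ?S" "(kernel_ideal Y :: ('i \<times> 'x, 'k) mpoly set) \<subseteq> kernel_ideal W"
          using below by blast
        then show "f \<in> kernel_ideal W" using f by blast
      qed
    qed
  qed
  also have "(\<Inter>Y\<in>?S. kernel_ideal Y :: ('i \<times> 'x, 'k) mpoly set) = (\<Inter>Y\<in>?S. component_ideal X0 G Y)"
    by (intro arg_cong[where f = "\<lambda>A. _ \<inter> A"] INF_cong refl)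
      (simp add: component_ideal_eq_kernel_ideal)
  finally show ?thesis unfolding binomial_edge_ideal_eq_Inter_all .
qed

text \<open>
  If some \<open>x \<in> Z\<close> is missing from \<open>Y\<close>, the variables at \<open>x\<close> distinguish the ideals. Otherwise
  \<open>Y\<close> contains a vertex \<open>x\<close> outside \<open>Z\<close>, which has neighbours \<open>y\<close> and \<open>z\<close> in different components
  of \<open>Z\<close>. They are connected through \<open>x\<close> in \<open>Y\<close>, so a binomial for \<open>y\<close> and \<open>z\<close> distinguishes the
  ideals; a nonzero one exists because there are two different indices.
\<close>

lemma kernel_ideals_incomparable:
  assumes "card X0 > 1" and "Y \<subseteq> V" and "separating G Y" and "Z \<subseteq> V" and "separating G Z"
    and "Y \<noteq> Z"
  shows "\<not> (kernel_ideal Y :: ('i \<times> 'x, 'k::field) mpoly set) \<subseteq> kernel_ideal Z"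
proof -
  obtain i j where ij: "i \<in> X0" "j \<in> X0" "i \<noteq> j"
    using assms(1) by (metis card_le_Suc0_iff_eq finite_X0 not_less One_nat_def)
  show ?thesis
  proof (cases "Z \<subseteq> Y")
    case False
    then obtain x where x: "x \<in> Z" "x \<notin> Y" by blast
    then have "(pvar i x :: ('i \<times> 'x, 'k) mpoly) \<in> carrier (poly_ring (X0 \<times> V))"
      unfolding pvar_def using ij assms by (intro poly_ring_closed) auto
    then have "(pvar i x :: ('i \<times> 'x, 'k) mpoly) \<in> kernel_ideal Y - kernel_ideal Z"
      using x ij by (auto simp: toric_kernel_def toric_pvar_eq_0_iff)
    then show ?thesis by blast
  next
    case True
    then obtain x where x: "x \<in> Y" "x \<notin> Z" using assms by blast
    then obtain y z where yz: "y \<in> Z" "z \<in> Z" "(x, y) \<in> parcs G" "(x, z) \<in> parcs G"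
        "(y, z) \<notin> conn Z"
      using assms separating_iff_joins_components[OF graph, of Z] verts unfolding joins_components_def by blast
    have "(y, x) \<in> parcs G" using yz sym_parcs by (auto dest: symD)
    then have "(y, z) \<in> conn Y"
      using yz x True by (meson rtrancl_on.intros subsetD)
    then have "(fbinom i j y z :: ('i \<times> 'x, 'k) mpoly) \<in> kernel_ideal Y"
      using yz ij assms by (intro fbinom_in_kernel_ideal) auto
    moreover have "toric Z (conn Z) (fbinom i j y z :: ('i \<times> 'x, 'k) mpoly) \<noteq> 0"
      using toric_fbinom_neq_0[OF assms(4) equiv_conn ij] yz by blast
    then have "(fbinom i j y z :: ('i \<times> 'x, 'k) mpoly) \<notin> kernel_ideal Z"
      by (simp add: toric_kernel_def)
    ultimately show ?thesis by blast
  qed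
qed

text \<open>
  A prime ideal that contains a finite intersection of ideals contains one of them: otherwise the
  product of elements of the individual kernels that lie outside the kernel on the right would be
  in the intersection, but its image is a product of nonzero elements of an integral domain.
\<close>

lemma Inter_subset_toric_kernel:
  fixes Q :: "'s \<Rightarrow> 'x set" and rel :: "'s \<Rightarrow> 'x rel"
  assumes "finite T"
    and "carrier (poly_ring (X0 \<times> V)) \<inter> (\<Inter>t\<in>T. toric_kernel (Q t) (rel t))
      \<subseteq> (toric_kernel Y r :: ('i \<times> 'x, 'k::field) mpoly set)"
  shows "\<exists>t\<in>T. (toric_kernel (Q t) (rel t) :: ('i \<times> 'x, 'k) mpoly set) \<subseteq> toric_kernel Y r"
proof (rule ccontr)
  assume "\<not> ?thesis"
  then have "\<forall>t\<in>T. \<exists>p. p \<in> toric_kernel (Q t) (rel t) - (toric_kernel Y r :: ('i \<times> 'x, 'k) mpoly set)"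
    by blast
  then obtain p :: "'s \<Rightarrow> ('i \<times> 'x, 'k) mpoly" where
    p: "\<And>t. t \<in> T \<Longrightarrow> p t \<in> toric_kernel (Q t) (rel t) - toric_kernel Y r"
    by metis
  have "(\<Prod>t\<in>T. p t) \<in> carrier (poly_ring (X0 \<times> V))"
    using p by (induction T rule: infinite_finite_induct) (auto simp: toric_kernel_def poly_ring_closed)
  moreover have "toric (Q t) (rel t) (\<Prod>t\<in>T. p t) = 0" if "t \<in> T" for t
    unfolding toric_prod using that p[OF that] assms(1) by (auto simp: toric_kernel_def)
  moreover have "toric Y r (\<Prod>t\<in>T. p t) \<noteq> 0"
    unfolding toric_prod using p assms(1) by (auto simp: toric_kernel_def)
  ultimately show False using assms(2) by (auto simp: toric_kernel_def)
qed

lemma binomial_edge_ideal_decomposition: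
  assumes "card X0 > 1"
  shows "irredundant_primary_decomposition
    (poly_ring (X0 \<times> V) :: ('i \<times> 'x, 'k::field) mpoly ring)
    (binomial_edge_ideal X0 G) {Y. Y \<subseteq> V \<and> separating G Y} (component_ideal X0 G)"
proof -
  let ?S = "{Y. Y \<subseteq> V \<and> separating G Y}"
  let ?R = "poly_ring (X0 \<times> V) :: ('i \<times> 'x, 'k) mpoly ring"
  let ?I = "component_ideal X0 G :: 'x set \<Rightarrow> ('i \<times> 'x, 'k) mpoly set"
  have fin: "finite ?S" using finite_V by auto
  have I: "?I Y = kernel_ideal Y" if "Y \<in> ?S" for Y
    using that component_ideal_eq_kernel_ideal by blast
  have irred: "\<not> carrier ?R \<inter> (\<Inter>t\<in>?S - {s}. ?I t) \<subseteq> ?I s" if s: "s \<in> ?S" for s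
  proof
    assume "carrier ?R \<inter> (\<Inter>t\<in>?S - {s}. ?I t) \<subseteq> ?I s"
    then have "carrier ?R \<inter> (\<Inter>t\<in>?S - {s}. kernel_ideal t) \<subseteq> kernel_ideal s"
      using I s by auto
    then have "\<exists>t\<in>?S - {s}. (kernel_ideal t :: ('i \<times> 'x, 'k) mpoly set) \<subseteq> kernel_ideal s"
      using fin by (intro Inter_subset_toric_kernel) auto
    then show False using kernel_ideals_incomparable[OF assms] s by blast
  qed
  have "inj_on (\<lambda>s. radical ?R (?I s)) ?S"
  proof (rule inj_onI)
    fix s t assume st: "s \<in> ?S" "t \<in> ?S" "radical ?R (?I s) = radical ?R (?I t)"
    then have "(kernel_ideal s :: ('i \<times> 'x, 'k) mpoly set) \<subseteq> kernel_ideal t"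
      by (simp add: component_ideal_eq_kernel_ideal radical_toric_kernel)
    then show "s = t" using kernel_ideals_incomparable[OF assms] st by blast
  qed
  moreover have "primary_ideal (?I s) ?R" if "s \<in> ?S" for s
    using I[OF that] primary_toric_kernel by metis
  ultimately show ?thesis
    unfolding irredundant_primary_decomposition_def
    using fin irred binomial_edge_ideal_eq_Inter_separating by (intro conjI ballI)
qed

end

end

theorem theorem7:
  fixes X0 :: "'i set" and Xin :: "'x set" and G :: "'x pair_pre_digraph"
  assumes "finite X0" and "finite Xin"
    and "card X0 > 1"
    and "pair_graph G" and "pverts G = Xin"
  shows "irredundant_primary_decomposition
           (poly_ring (X0 \<times> Xin) :: ('i \<times> 'x, 'k::field) mpoly ring)
           (binomial_edge_ideal X0 G)
           {Y. Y \<subseteq> Xin \<and> separating G Y}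
           (component_ideal X0 G)
       \<and> (\<forall>Y. Y \<subseteq> Xin \<longrightarrow> (separating G Y \<longleftrightarrow> component_reducing G Y))"
proof
  have "finite (Inl ` Xin \<union> Inr ` (X0 \<times> Pow Xin) :: ('x + 'i \<times> 'x set) set)"
    using assms(1,2) by simp
  from finite_imp_inj_to_nat_seg[OF this] obtain enc :: "'x + 'i \<times> 'x set \<Rightarrow> nat" where
    "inj_on enc (Inl ` Xin \<union> Inr ` (X0 \<times> Pow Xin))"
    by (elim exE conjE)
  then interpret exponent_code X0 Xin enc
    using assms(1,2) by unfold_locales
  show "irredundant_primary_decomposition
      (poly_ring (X0 \<times> Xin) :: ('i \<times> 'x, 'k) mpoly ring)
      (binomial_edge_ideal X0 G) {Y. Y \<subseteq> Xin \<and> separating G Y} (component_ideal X0 G)"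
    using assms(4,5,3) by (rule binomial_edge_ideal_decomposition)
  show "\<forall>Y. Y \<subseteq> Xin \<longrightarrow> (separating G Y \<longleftrightarrow> component_reducing G Y)"
    using separating_iff_joins_components[OF assms(4)] component_reducing_iff_joins_components[OF assms(4)] assms(5)
    by blast
qed

end
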